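(* Let $\mathcal{A}$ be a finite alphabet, let $X=\mathcal{A}^{\mathbb{Z}_-}$, and let $K\subset X$ be a subshift. The following are equivalent: (i) $K$ is of finite type. (ii) $K_e$ is closed. (iii) $K\cap\overline{K_e}=\emptyset$.
   Context: $\mathbb{Z}_-=\{0,-1,-2,\dots\}$. The alphabet $\mathcal{A}$ (nonempty) carries the discrete topology, and $X=\mathcal{A}^{\mathbb{Z}_-}$, the set of all sequences $x=(\dots,x_{-1},x_0)$ with entries in $\mathcal{A}$, carries the product topology. The shift $\Theta:X\to X$ is $\Theta(x)_j=x_{j-1}$, $j\in\mathbb{Z}_-$ (it deletes the last symbol $x_0$). A subshift of $X$ is a closed nonempty subset $K\subset X$ with $K=\Theta(K)$. A finite word $w$ over $\mathcal{A}$ appears in $x\in X$ if $(x_i,\dots,x_j)=w$ for some $i\le j\le 0$. For a set $\mathscr{F}$ of finite words over $\mathcal{A}$, $X_{\mathscr{F}}$ is the set of all $x\in X$ in which no word of $\mathscr{F}$ appears. A subshift $K$ is of finite type if $K=X_{\mathscr{F}}$ for some set $\mathscr{F}$ containing only finitely many words. $K^c$ is the complement of $K$ in $X$, overline denotes closure in $X$, and $K_e=\{x\in K^c:\Theta(x)\in K\}$. *)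

theory Defs
  imports "HOL-Analysis.Analysis"
begin

text \<open>
  Left-infinite sequences over an alphabet \<open>A\<close> are functions on the index set \<open>{..0::int}\<close>, made
  canonical by requiring the value \<open>undefined\<close> at positive indices, as in \<open>product_topology\<close>.
\<close>

definition left_seqs :: "'a set \<Rightarrow> (int \<Rightarrow> 'a) set" where
  "left_seqs A = ({..0} \<rightarrow>\<^sub>E A)"

definition left_seq_topology :: "'a set \<Rightarrow> (int \<Rightarrow> 'a) topology" where
  "left_seq_topology A = product_topology (\<lambda>_. discrete_topology A) {..0}"

lemma topspace_left_seq_topology [simp]: "topspace (left_seq_topology A) = left_seqs A"
  by (simp add: left_seq_topology_def left_seqs_def)

definition left_shift :: "(int \<Rightarrow> 'a) \<Rightarrow> int \<Rightarrow> 'a" where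
  "left_shift x = (\<lambda>j\<in>{..0}. x (j - 1))"

definition subshift :: "'a set \<Rightarrow> (int \<Rightarrow> 'a) set \<Rightarrow> bool" where
  "subshift A K \<longleftrightarrow>
     closedin (left_seq_topology A) K \<and> K \<noteq> {} \<and> K = left_shift ` K"

text \<open>Since \<open>i \<le> j\<close> is required, the empty word appears in no sequence.\<close>

definition appears_in :: "'a list \<Rightarrow> (int \<Rightarrow> 'a) \<Rightarrow> bool" where
  "appears_in w x \<longleftrightarrow> (\<exists>i j. i \<le> j \<and> j \<le> 0 \<and> map x [i..j] = w)"

definition avoiding_seqs :: "'a set \<Rightarrow> 'a list set \<Rightarrow> (int \<Rightarrow> 'a) set" where
  "avoiding_seqs A F = {x \<in> left_seqs A. \<forall>w\<in>F. \<not> appears_in w x}"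

definition finite_type :: "'a set \<Rightarrow> (int \<Rightarrow> 'a) set \<Rightarrow> bool" where
  "finite_type A K \<longleftrightarrow> (\<exists>F. F \<subseteq> lists A \<and> finite F \<and> K = avoiding_seqs A F)"

text \<open>The set written \<open>K\<^sub>e\<close>: sequences outside \<open>K\<close> that the shift maps into \<open>K\<close>.\<close>

definition exit_set :: "'a set \<Rightarrow> (int \<Rightarrow> 'a) set \<Rightarrow> (int \<Rightarrow> 'a) set" where
  "exit_set A K = {x \<in> left_seqs A - K. left_shift x \<in> K}"

end

theory Submission
  imports Defs
begin

text \<open>
  The three conditions all say that \<open>K\<close> and its exit set are separated by a finite window: for some
  \<open>N\<close>, no point of \<open>K\<close> and no point of \<open>exit_set A K\<close> carry the same symbols on \<open>{-N..0}\<close>.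

  If finitely many forbidden words describe \<open>K\<close>, then a forbidden word occurring in a point of the
  exit set must end at coordinate \<open>0\<close>, since deleting the last symbol leads into \<open>K\<close>; a window longer
  than all forbidden words therefore separates (\<open>finite_type_imp_separating_window\<close>).

  Conversely, given a separating window, forbid all words of its length that occur in no point of
  \<open>K\<close>. Every final block of a sequence \<open>y\<close> without forbidden words can be built up inside \<open>K\<close>: start
  with a point of \<open>K\<close> ending in one window of \<open>y\<close> and append the following symbols of \<open>y\<close> one at a
  time. Appending a symbol to a point of \<open>K\<close> gives a point of \<open>K\<close> or of the exit set, and the second
  case is excluded because the new last window again occurs in \<open>K\<close>. Hence points of \<open>K\<close> approximate
  \<open>y\<close> arbitrarily well, and \<open>y \<in> K\<close> because \<open>K\<close> is closed
  (\<open>separating_window_imp_finite_type\<close>).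

  Topologically, disjointness of \<open>K\<close> from the closure of the exit set gives each point of \<open>K\<close> its
  own separating window; finiteness of the alphabet makes \<open>K\<close> compact, so one window serves for all
  points (\<open>disjoint_closure_iff_separating_window\<close>). Finally every limit of the exit set is still shifted
  into \<open>K\<close>, so that the only limits it can lack are points of \<open>K\<close>
  (\<open>closedin_exit_set_iff_disjoint\<close>).
\<close>

section \<open>Windows and the topology of left-infinite sequences\<close>

definition agree :: "nat \<Rightarrow> (int \<Rightarrow> 'a) \<Rightarrow> (int \<Rightarrow> 'a) \<Rightarrow> bool" where
  "agree n x y \<longleftrightarrow> (\<forall>i\<in>{- int n..0}. x i = y i)"

lemma agree_refl [simp]: "agree n x x"
  by (simp add: agree_def)

lemma agree_trans: "agree n x y \<Longrightarrow> agree n y z \<Longrightarrow> agree n x z"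
  by (simp add: agree_def)

lemma agree_mono: "agree n x y \<Longrightarrow> m \<le> n \<Longrightarrow> agree m x y"
  by (simp add: agree_def)

lemma openin_agree:
  assumes "x \<in> left_seqs A"
  shows "openin (left_seq_topology A) {y \<in> left_seqs A. agree n x y}"
proof -
  have "{y \<in> left_seqs A. agree n x y}
      = (\<Pi>\<^sub>E i\<in>{..0}. if i \<in> {- int n..0} then {x i} else A)"
    using assms unfolding left_seqs_def agree_def PiE_def Pi_def extensional_def
    by (fastforce split: if_splits)
  moreover have "{i \<in> {..0}. (if i \<in> {- int n..0} then {x i} else A) \<noteq> A} \<subseteq> {- int n..0}"
    by auto
  then have "finite {i \<in> {..0}. (if i \<in> {- int n..0} then {x i} else A) \<noteq> A}"
    using finite_subset by blast
  ultimately show ?thesis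
    using assms unfolding left_seq_topology_def left_seqs_def
    by (auto simp: openin_PiE_gen PiE_iff)
qed

lemma openin_left_seq_topology_iff:
  "openin (left_seq_topology A) U \<longleftrightarrow>
     U \<subseteq> left_seqs A \<and> (\<forall>x\<in>U. \<exists>n. \<forall>y\<in>left_seqs A. agree n x y \<longrightarrow> y \<in> U)"
    (is "?L \<longleftrightarrow> ?R")
proof
  assume ?L
  show ?R
  proof (intro conjI ballI)
    show sub: "U \<subseteq> left_seqs A"
      using openin_subset[OF \<open>?L\<close>] by simp
    fix x assume "x \<in> U"
    then obtain B where B: "finite {i \<in> {..0}. B i \<noteq> A}" "x \<in> Pi\<^sub>E {..0} B" "Pi\<^sub>E {..0} B \<subseteq> U"
      using \<open>?L\<close> unfolding left_seq_topology_def openin_product_topology_alt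
      by (auto simp: Ball_def)
    \<comment> \<open>Only finitely many coordinates of the basic neighbourhood are constrained, so a window
      reaching back to the smallest of them suffices.\<close>
    obtain k where k: "\<And>i. i \<in> {i \<in> {..0}. B i \<noteq> A} \<Longrightarrow> k \<le> i"
      using bdd_below_finite[OF B(1)] unfolding bdd_below_def by blast
    have "y \<in> U" if y: "y \<in> left_seqs A" "agree (nat (- k)) x y" for y
    proof -
      have "y i \<in> B i" if "i \<le> 0" for i
      proof (cases "B i = A")
        case True
        then show ?thesis using y(1) that by (auto simp: left_seqs_def)
      next
        case False
        then have "k \<le> i" using k that by auto
        then have "y i = x i" using y(2) that by (auto simp: agree_def)
        then show ?thesis using B(2) that by auto
      qed
      then have "y \<in> Pi\<^sub>E {..0} B"
        using y(1) by (simp add: left_seqs_def PiE_iff)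
      then show ?thesis using B(3) by blast
    qed
    then show "\<exists>n. \<forall>y\<in>left_seqs A. agree n x y \<longrightarrow> y \<in> U" by blast
  qed
next
  assume R: ?R
  show ?L
  proof (subst openin_subopen, intro ballI)
    fix x assume "x \<in> U"
    then obtain n where "\<forall>y\<in>left_seqs A. agree n x y \<longrightarrow> y \<in> U" and "x \<in> left_seqs A"
      using R by blast
    then show "\<exists>T. openin (left_seq_topology A) T \<and> x \<in> T \<and> T \<subseteq> U"
      by (intro exI[of _ "{y \<in> left_seqs A. agree n x y}"]) (auto simp: openin_agree)
  qed
qed

lemma in_closure_of_left_seq_topology_iff:
  "x \<in> left_seq_topology A closure_of S \<longleftrightarrow>
     x \<in> left_seqs A \<and> (\<forall>n. \<exists>y\<in>S \<inter> left_seqs A. agree n x y)"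
    (is "?L \<longleftrightarrow> ?R")
proof
  assume L: ?L
  then have x: "x \<in> left_seqs A"
    by (simp add: in_closure_of)
  moreover have "\<exists>y\<in>S \<inter> left_seqs A. agree n x y" for n
  proof -
    have "x \<in> {y \<in> left_seqs A. agree n x y}"
      using x by simp
    then obtain y where "y \<in> S" "y \<in> {y \<in> left_seqs A. agree n x y}"
      using L openin_agree[OF x, of n] unfolding in_closure_of by meson
    then show ?thesis by blast
  qed
  ultimately show ?R by blast
next
  assume R: ?R
  have "\<exists>y. y \<in> S \<and> y \<in> T" if T: "x \<in> T" "openin (left_seq_topology A) T" for T
  proof -
    obtain n where n: "\<forall>y\<in>left_seqs A. agree n x y \<longrightarrow> y \<in> T"
      using T unfolding openin_left_seq_topology_iff by meson
    obtain y where "y \<in> S" "y \<in> left_seqs A" "agree n x y"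
      using R by blast
    then show ?thesis using n by blast
  qed
  then show ?L using R by (simp add: in_closure_of)
qed

lemma closedin_approx:
  assumes "closedin (left_seq_topology A) K" "x \<in> left_seqs A" "\<And>n. \<exists>y\<in>K. agree n x y"
  shows "x \<in> K"
proof -
  have "K \<subseteq> left_seqs A"
    using closedin_subset[OF assms(1)] by simp
  then have "x \<in> left_seq_topology A closure_of K"
    using assms(2,3) unfolding in_closure_of_left_seq_topology_iff by blast
  then show ?thesis
    using closure_of_closedin[OF assms(1)] by simp
qed

lemma compact_space_left_seq_topology:
  "finite A \<Longrightarrow> compact_space (left_seq_topology A)"
  by (simp add: left_seq_topology_def compact_space_product_topology compact_space_discrete_topology)

section \<open>Shifting\<close>

lemma left_shift_in_left_seqs: "x \<in> left_seqs A \<Longrightarrow> left_shift x \<in> left_seqs A"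
  by (auto simp: left_seqs_def left_shift_def)

lemma agree_left_shift: "agree (Suc n) x y \<Longrightarrow> agree n (left_shift x) (left_shift y)"
  by (auto simp: agree_def left_shift_def)

lemma left_shift_funpow_apply: "i \<le> 0 \<Longrightarrow> (left_shift ^^ n) x i = x (i - int n)"
  by (induction n arbitrary: i) (auto simp: left_shift_def algebra_simps)

lemma subshift_subset: "subshift A K \<Longrightarrow> K \<subseteq> left_seqs A"
  unfolding subshift_def using closedin_subset[of "left_seq_topology A" K] by simp

lemma subshift_left_shift: "subshift A K \<Longrightarrow> x \<in> K \<Longrightarrow> left_shift x \<in> K"
  unfolding subshift_def by blast

lemma subshift_funpow: "subshift A K \<Longrightarrow> x \<in> K \<Longrightarrow> (left_shift ^^ n) x \<in> K"
  by (induction n) (auto intro: subshift_left_shift)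

lemma appears_in_left_shift:
  assumes "i \<le> j" "j < 0" "map x [i..j] = w"
  shows "appears_in w (left_shift x)"
proof -
  have "map (left_shift x) [i+1..j+1] = map x [i..j]"
    using assms by (intro nth_equalityI) (auto simp: left_shift_def)
  then show ?thesis
    using assms unfolding appears_in_def by (intro exI[of _ "i+1"] exI[of _ "j+1"]) auto
qed

text \<open>
  Whatever stands to the right of an occurrence can be shifted away without leaving \<open>K\<close>.
\<close>

lemma subshift_appears_at_end:
  assumes "subshift A K" "x \<in> K" "appears_in (map y [p - int n..p]) x"
  obtains z where "z \<in> K" "\<And>i. i \<in> {- int n..0} \<Longrightarrow> z i = y (p + i)"
proof -
  obtain k l where kl: "k \<le> l" "l \<le> 0" "map x [k..l] = map y [p - int n..p]"
    using assms(3) unfolding appears_in_def by blast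
  have "length [k..l] = length [p - int n..p]"
    using arg_cong[OF kl(3), of length] by simp
  then have k: "k = l - int n"
    using kl(1) by simp
  show ?thesis
  proof
    show "(left_shift ^^ nat (- l)) x \<in> K"
      using assms by (intro subshift_funpow)
    fix i :: int assume i: "i \<in> {- int n..0}"
    then have "map x [k..l] ! nat (int n + i) = map y [p - int n..p] ! nat (int n + i)"
      using kl(3) by simp
    then have "x (l + i) = y (p + i)"
      using i k by simp
    then show "(left_shift ^^ nat (- l)) x i = y (p + i)"
      using i kl(2) by (simp add: left_shift_funpow_apply add.commute)
  qed
qed

section \<open>Separating windows and finite type\<close>

lemma exit_set_subset: "exit_set A K \<subseteq> left_seqs A"
  by (auto simp: exit_set_def)

definition separating_window :: "'a set \<Rightarrow> (int \<Rightarrow> 'a) set \<Rightarrow> nat \<Rightarrow> bool" where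
  "separating_window A K n \<longleftrightarrow> (\<forall>x\<in>K. \<forall>y\<in>exit_set A K. \<not> agree n x y)"

text \<open>
  A forbidden word in a point of the exit set sits at the right end, where a long enough window
  carries it over to every point that agrees on the window.
\<close>

lemma finite_type_imp_separating_window:
  assumes "finite_type A K"
  shows "\<exists>n. separating_window A K n"
proof -
  obtain F where F: "finite F" "K = avoiding_seqs A F"
    using assms unfolding finite_type_def by blast
  obtain n where n: "\<And>w. w \<in> F \<Longrightarrow> length w \<le> n"
    using finite_nat_set_iff_bounded_le[of "length ` F"] F(1) by auto
  have "\<not> agree n x y" if x: "x \<in> K" and y: "y \<in> exit_set A K" for x y
  proof
    assume agree: "agree n x y"
    from y obtain w where w: "w \<in> F" "appears_in w y"
      unfolding exit_set_def F(2) avoiding_seqs_def by blast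
    then obtain i j where ij: "i \<le> j" "j \<le> 0" "map y [i..j] = w"
      unfolding appears_in_def by blast
    have "\<not> appears_in w (left_shift y)"
      using y w(1) unfolding exit_set_def F(2) avoiding_seqs_def by blast
    then have j: "j = 0"
      using appears_in_left_shift[OF ij(1) _ ij(3)] ij(2) by fastforce
    have "- int n \<le> i"
      using n[OF w(1)] ij j by auto
    then have "map x [i..j] = w"
      using agree j ij(3) by (auto simp: agree_def)
    then have "appears_in w x"
      using ij unfolding appears_in_def by blast
    then show False
      using x w(1) unfolding F(2) avoiding_seqs_def by blast
  qed
  then show ?thesis unfolding separating_window_def by blast
qed

text \<open>
  Appending the symbol \<open>a\<close> to \<open>z \<in> K\<close> either stays in \<open>K\<close> or enters the exit set; a point of \<open>K\<close>
  with the same last window rules out the latter.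
\<close>

lemma separating_window_append:
  assumes K: "K \<subseteq> left_seqs A" and sep: "separating_window A K n" and z: "z \<in> K" and a: "a \<in> A"
    and x: "x \<in> K" "x 0 = a" "\<And>i. i \<in> {- int n..-1} \<Longrightarrow> x i = z (i + 1)"
  shows "(\<lambda>i\<in>{..0}. if i = 0 then a else z (i + 1)) \<in> K"
proof (rule ccontr)
  let ?z = "\<lambda>i\<in>{..0}. if i = 0 then a else z (i + 1)"
  assume "?z \<notin> K"
  have zA: "z \<in> left_seqs A"
    using z K by blast
  then have "z (i + 1) \<in> A" if "i \<le> 0" "i \<noteq> 0" for i
    using that by (simp add: left_seqs_def PiE_iff)
  then have "?z \<in> left_seqs A"
    using a by (simp add: left_seqs_def)
  moreover have "left_shift ?z = z"
  proof
    show "left_shift ?z i = z i" for i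
      using zA by (cases "i \<le> 0") (auto simp: left_shift_def left_seqs_def PiE_iff extensional_def)
  qed
  ultimately have "?z \<in> exit_set A K"
    using \<open>?z \<notin> K\<close> z by (simp add: exit_set_def)
  moreover have "agree n x ?z"
    using x by (auto simp: agree_def)
  ultimately show False
    using sep x(1) unfolding separating_window_def by blast
qed

lemma separating_window_imp_finite_type:
  assumes A: "finite A" and sub: "subshift A K" and sep: "separating_window A K n"
  shows "finite_type A K"
proof -
  define F where "F = {w \<in> lists A. length w = Suc n \<and> (\<forall>x\<in>K. \<not> appears_in w x)}"
  have KA: "K \<subseteq> left_seqs A"
    using sub by (rule subshift_subset)
  have "F \<subseteq> {w. set w \<subseteq> A \<and> length w = Suc n}"
    by (auto simp: F_def)
  then have "finite F"
    using finite_lists_length_eq[OF A] by (rule finite_subset)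
  moreover have "F \<subseteq> lists A"
    by (auto simp: F_def)
  moreover have "K = avoiding_seqs A F"
  proof (intro subset_antisym subsetI)
    show "x \<in> avoiding_seqs A F" if "x \<in> K" for x
      using that KA by (auto simp: avoiding_seqs_def F_def)
    fix y assume y: "y \<in> avoiding_seqs A F"
    then have yA: "y \<in> left_seqs A"
      by (simp add: avoiding_seqs_def)
    then have sym: "y i \<in> A" if "i \<le> 0" for i
      using that by (auto simp: left_seqs_def)
    have window: "\<exists>x\<in>K. \<forall>i\<in>{- int n..0}. x i = y (p + i)" if p: "p \<le> 0" for p
    proof -
      let ?w = "map y [p - int n..p]"
      have "appears_in ?w y"
        using p unfolding appears_in_def by (intro exI[of _ "p - int n"] exI[of _ p]) simp
      then have "?w \<notin> F"
        using y by (auto simp: avoiding_seqs_def)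
      moreover have "?w \<in> lists A" "length ?w = Suc n"
        using p sym by auto
      ultimately obtain x where "x \<in> K" "appears_in ?w x"
        unfolding F_def by blast
      then show ?thesis
        using subshift_appears_at_end[OF sub] by metis
    qed
    \<comment> \<open>The end position \<open>p\<close> must vary: the block ending at \<open>p\<close> is obtained by appending one
      symbol to the shorter block ending at \<open>p - 1\<close>.\<close>
    have block: "\<exists>z\<in>K. \<forall>i\<in>{- int (n + d)..0}. z i = y (p + i)" if "p \<le> 0" for p d
      using that
    proof (induction d arbitrary: p)
      case 0
      then show ?case using window by simp
    next
      case (Suc d)
      have "p - 1 \<le> 0" using Suc.prems by simp
      from Suc.IH[OF this] obtain z
        where z: "z \<in> K" "\<And>i. i \<in> {- int (n + d)..0} \<Longrightarrow> z i = y (p - 1 + i)"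
        by blast
      obtain x where x: "x \<in> K" "\<And>i. i \<in> {- int n..0} \<Longrightarrow> x i = y (p + i)"
        using window[OF Suc.prems] by blast
      let ?z = "\<lambda>i\<in>{..0}. if i = 0 then y p else z (i + 1)"
      have "?z \<in> K"
      proof (rule separating_window_append[OF KA sep z(1) sym[OF Suc.prems] x(1)])
        show "x 0 = y p" using x(2)[of 0] by simp
        show "x i = z (i + 1)" if "i \<in> {- int n..-1}" for i
          using that x(2)[of i] z(2)[of "i + 1"] by simp
      qed
      moreover have "?z i = y (p + i)" if "i \<in> {- int (n + Suc d)..0}" for i
        using that z(2)[of "i + 1"] by auto
      ultimately show ?case by blast
    qed
    have "\<exists>z\<in>K. agree d y z" for d
    proof -
      obtain z where "z \<in> K" "\<forall>i\<in>{- int (n + d)..0}. z i = y (0 + i)"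
        using block[of 0 d] by blast
      then have "agree d y z"
        by (simp add: agree_def)
      then show ?thesis using \<open>z \<in> K\<close> ..
    qed
    then show "y \<in> K"
      using closedin_approx[OF _ yA] sub unfolding subshift_def by blast
  qed
  ultimately show ?thesis unfolding finite_type_def by blast
qed

section \<open>Separating windows and the closure of the exit set\<close>

text \<open>
  The points of \<open>K\<close> that the window \<open>{-n..0}\<close> separates from the exit set are those in an open set
  \<open>V n\<close>, and these sets increase with \<open>n\<close>; if they cover the compact set \<open>K\<close>, one of them contains it.
\<close>

lemma disjoint_closure_iff_separating_window:
  assumes A: "finite A" and K: "closedin (left_seq_topology A) K"
  shows "K \<inter> (left_seq_topology A closure_of exit_set A K) = {} \<longleftrightarrow> (\<exists>n. separating_window A K n)"
proof
  have KA: "K \<subseteq> left_seqs A"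
    using closedin_subset[OF K] by simp
  assume disj: "K \<inter> (left_seq_topology A closure_of exit_set A K) = {}"
  define V where "V n = {x \<in> left_seqs A. \<forall>y\<in>exit_set A K. \<not> agree n x y}" for n
  have "openin (left_seq_topology A) (V n)" for n
  proof -
    have "x' \<in> V n" if "x \<in> V n" "x' \<in> left_seqs A" "agree n x x'" for x x'
      using that by (auto simp: V_def dest: agree_trans[of n x x'])
    moreover have "V n \<subseteq> left_seqs A"
      by (auto simp: V_def)
    ultimately show ?thesis
      unfolding openin_left_seq_topology_iff by meson
  qed
  moreover have "K \<subseteq> (\<Union>n. V n)"
  proof
    fix x assume x: "x \<in> K"
    then have "x \<notin> left_seq_topology A closure_of exit_set A K"
      using disj by blast
    then obtain n where "\<forall>y\<in>exit_set A K \<inter> left_seqs A. \<not> agree n x y"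
      using x KA unfolding in_closure_of_left_seq_topology_iff by blast
    then have "x \<in> V n"
      using x KA exit_set_subset by (fastforce simp: V_def)
    then show "x \<in> (\<Union>n. V n)" by blast
  qed
  moreover have "compactin (left_seq_topology A) K"
    using closedin_compact_space[OF compact_space_left_seq_topology[OF A] K] .
  ultimately obtain \<V> where "finite \<V>" "\<V> \<subseteq> range V" "K \<subseteq> \<Union>\<V>"
    using compactinD[of "left_seq_topology A" K "range V"] by auto
  then obtain I where I: "finite I" "K \<subseteq> (\<Union>n\<in>I. V n)"
    using finite_subset_image[of \<V> V UNIV] by auto
  then obtain N where N: "\<forall>n\<in>I. n \<le> N"
    using finite_nat_set_iff_bounded_le by blast
  have "\<not> agree N x y" if "x \<in> K" "y \<in> exit_set A K" for x y
  proof -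
    obtain n where n: "n \<in> I" "x \<in> V n"
      using I(2) \<open>x \<in> K\<close> by blast
    then have "\<not> agree n x y"
      using \<open>y \<in> exit_set A K\<close> by (simp add: V_def)
    then show ?thesis
      using N n(1) agree_mono by blast
  qed
  then have "separating_window A K N"
    by (simp add: separating_window_def)
  then show "\<exists>n. separating_window A K n" ..
next
  assume "\<exists>n. separating_window A K n"
  then show "K \<inter> (left_seq_topology A closure_of exit_set A K) = {}"
    unfolding separating_window_def in_closure_of_left_seq_topology_iff disjoint_iff by blast
qed

text \<open>
  The shift is continuous and \<open>K\<close> is closed, so a limit of the exit set is shifted into \<open>K\<close>; it
  belongs to the exit set as soon as it lies outside \<open>K\<close>.
\<close>

lemma closedin_exit_set_iff_disjoint:
  assumes K: "closedin (left_seq_topology A) K"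
  shows "closedin (left_seq_topology A) (exit_set A K) \<longleftrightarrow>
           K \<inter> (left_seq_topology A closure_of exit_set A K) = {}"
proof
  assume "closedin (left_seq_topology A) (exit_set A K)"
  then show "K \<inter> (left_seq_topology A closure_of exit_set A K) = {}"
    by (auto simp: closure_of_closedin exit_set_def)
next
  assume disj: "K \<inter> (left_seq_topology A closure_of exit_set A K) = {}"
  have "y \<in> exit_set A K" if y: "y \<in> left_seq_topology A closure_of exit_set A K" for y
  proof -
    have yA: "y \<in> left_seqs A"
      using y by (simp add: in_closure_of)
    have "\<exists>z\<in>K. agree n (left_shift y) z" for n
    proof -
      obtain z where "z \<in> exit_set A K" "agree (Suc n) y z"
        using y unfolding in_closure_of_left_seq_topology_iff by blast
      then show ?thesis
        by (auto simp: exit_set_def dest: agree_left_shift)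
    qed
    then have "left_shift y \<in> K"
      by (rule closedin_approx[OF K left_shift_in_left_seqs[OF yA]])
    then show ?thesis
      using disj y yA by (auto simp: exit_set_def)
  qed
  then show "closedin (left_seq_topology A) (exit_set A K)"
    using exit_set_subset[of A K] by (simp add: closure_of_subset_eq[symmetric] subset_iff)
qed

theorem proposition2:
  fixes A :: "'a set" and K :: "(int \<Rightarrow> 'a) set"
  assumes "finite A" and "A \<noteq> {}" and "subshift A K"
  shows "(finite_type A K \<longleftrightarrow> closedin (left_seq_topology A) (exit_set A K)) \<and>
         (closedin (left_seq_topology A) (exit_set A K) \<longleftrightarrow>
            K \<inter> (left_seq_topology A closure_of exit_set A K) = {})"
proof -
  have K: "closedin (left_seq_topology A) K"
    using assms(3) by (simp add: subshift_def)
  have "finite_type A K \<longleftrightarrow> (\<exists>n. separating_window A K n)"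
    using finite_type_imp_separating_window separating_window_imp_finite_type[OF assms(1,3)]
    by blast
  then show ?thesis
    using disjoint_closure_iff_separating_window[OF assms(1) K] closedin_exit_set_iff_disjoint[OF K]
    by blast
qed

end
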